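(* Let $\gamma\in(0,1)$, $\nu>0$, and let a sequence of sparse vectors $\{\mathbf{x}^{(M)}\in\mathbb{C}^M\}_M$ with $\|\mathbf{x}^{(M)}\|_0=L=o(M)$ be given such that $P=\|\mathbf{x}^{(M)}\|_2^2$ is constant (independent of $M$). Then there is a constant $C'_5>0$, depending only on $\gamma$, $P$ and $\nu$, such that asymptotic reliable recovery is possible for $\{\mathbf{x}^{(M)}\}$ with respect to Error Metric 3 if $N\succ C'_5\,L\log(M-L)$.
   Context: Model: $\nu>0$ is fixed. For each $M$, $\mathbf{x}=\mathbf{x}^{(M)}\in\mathbb{C}^M$ has support $\mathcal{I}=\{i: x_i\ne 0\}$ with $\|\mathbf{x}\|_0=|\mathcal{I}|=L=L(M)\ge1$, where $L=o(M)$ as $M\to\infty$, and $P=\|\mathbf{x}\|_2^2$. The number of measurements $N=N(M)\ge 1$ is a function of $M$. One observes $\mathbf{y}=\mathbf{A}\mathbf{x}+\mathbf{n}\in\mathbb{C}^N$, where $\mathbf{A}$ is an $N\times M$ Gaussian measurement matrix with i.i.d. circularly symmetric complex Gaussian entries of mean $0$ and variance $1$ ($\mathcal{N}_C(0,1)$), and $\mathbf{n}\sim\mathcal{N}_C(0,\nu^2 I_N)$ is independent of $\mathbf{A}$. Decoder: a (measurable) decoder $\mathcal{D}$ maps $\mathbf{y}$ (with $\mathbf{A}$ known) to a set $\mathcal{D}(\mathbf{y})=\mathcal{D}(\mathbf{y},\mathbf{A})\subset\{1,\dots,M\}$ of exactly $L$ indices. It may depend on $M,N,L,\nu,\gamma$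 and on the values of the nonzero entries of $\mathbf{x}$, but has no a priori information about the support: for every permutation $\pi$ of $\{1,\dots,M\}$ and every $\mathbf{A}$ with pairwise distinct columns, if $\mathbf{A}^\pi$ is the matrix whose $\pi(j)$-th column is the $j$-th column of $\mathbf{A}$, then $\mathcal{D}(\mathbf{y},\mathbf{A}^\pi)=\pi(\mathcal{D}(\mathbf{y},\mathbf{A}))$. Error Metric 3 (parameter $\gamma\in(0,1)$): recovery is successful iff $\sum_{k\in\mathcal{D}(\mathbf{y})\cap\mathcal{I}}|x_k|^2>(1-\gamma)P$; otherwise an error occurs. Let $p_{\rm err}(\mathbf{A}|\mathbf{x}^{(M)})$ be the probability of error over $\mathbf{n}$ for fixed $\mathbf{A}$, and $p_{\rm err}(\mathcal{D}|\mathbf{x}^{(M)})=\mathbb{E}_{\mathbf{A}}\,p_{\rm err}(\mathbf{A}|\mathbf{x}^{(M)})$. Asymptotic reliable recovery is possible if there is a sequence of decoders with $p_{\rm err}(\mathcal{D}|\mathbf{x}^{(M)})\to 0$ as $M\to\infty$. Notation: for functions $f,g$ of $M$, $f\succ g$ means that either $f=g=0$, or $f,g$ are non-decreasing non-negative functions and there is $M_0$ with $f(M)/g(M)>1$ for all $M>M_0$. *)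

theory Defs
  imports "HOL-Probability.Probability" "HOL-Library.Landau_Symbols"
begin

text \<open>Vectors and matrices of varying size are functions on the index sets
  \<open>{1..M}\<close>, \<open>{1..N}\<close> and \<open>{1..N} \<times> {1..M}\<close> (row, column).\<close>

definition supp :: "nat \<Rightarrow> (nat \<Rightarrow> complex) \<Rightarrow> nat set" where
  "supp M x = {i \<in> {1..M}. x i \<noteq> 0}"

definition sparsity :: "nat \<Rightarrow> (nat \<Rightarrow> complex) \<Rightarrow> nat" where
  "sparsity M x = card (supp M x)"

definition energy :: "nat \<Rightarrow> (nat \<Rightarrow> complex) \<Rightarrow> real" where
  "energy M x = (\<Sum>i=1..M. (cmod (x i))\<^sup>2)"

text \<open>Circularly symmetric complex Gaussian of mean \<open>0\<close> and variance \<open>v\<close>: the real and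
  imaginary parts are independent real Gaussians of variance \<open>v / 2\<close> each.  The second argument
  of \<^const>\<open>normal_density\<close> is the standard deviation.\<close>

definition complex_gaussian :: "real \<Rightarrow> complex measure" where
  "complex_gaussian v =
     distr (density lborel (normal_density 0 (sqrt (v / 2))) \<Otimes>\<^sub>M
            density lborel (normal_density 0 (sqrt (v / 2))))
       borel (\<lambda>(a, b). Complex a b)"

definition gaussian_matrix :: "nat \<Rightarrow> nat \<Rightarrow> (nat \<times> nat \<Rightarrow> complex) measure" where
  "gaussian_matrix N M = (\<Pi>\<^sub>M ij \<in> {1..N} \<times> {1..M}. complex_gaussian 1)"

definition gaussian_noise :: "real \<Rightarrow> nat \<Rightarrow> (nat \<Rightarrow> complex) measure" where
  "gaussian_noise \<nu> N = (\<Pi>\<^sub>M i \<in> {1..N}. complex_gaussian (\<nu>\<^sup>2))"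

definition observation ::
  "nat \<Rightarrow> nat \<Rightarrow> (nat \<Rightarrow> complex) \<Rightarrow> (nat \<times> nat \<Rightarrow> complex) \<Rightarrow> (nat \<Rightarrow> complex) \<Rightarrow> nat \<Rightarrow> complex"
where
  "observation N M x A n = (\<lambda>i\<in>{1..N}. (\<Sum>j=1..M. A (i, j) * x j) + n i)"

text \<open>Column \<open>\<pi> j\<close> of the permuted matrix is column \<open>j\<close> of \<open>A\<close>.\<close>

definition permute_columns ::
  "nat \<Rightarrow> nat \<Rightarrow> (nat \<Rightarrow> nat) \<Rightarrow> (nat \<times> nat \<Rightarrow> complex) \<Rightarrow> nat \<times> nat \<Rightarrow> complex"
where
  "permute_columns N M \<pi> A = (\<lambda>(i, j) \<in> {1..N} \<times> {1..M}. A (i, inv \<pi> j))"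

definition distinct_columns :: "nat \<Rightarrow> nat \<Rightarrow> (nat \<times> nat \<Rightarrow> complex) \<Rightarrow> bool" where
  "distinct_columns N M A \<longleftrightarrow> inj_on (\<lambda>j. \<lambda>i\<in>{1..N}. A (i, j)) {1..M}"

text \<open>A decoder for a given problem instance.  It is chosen after all parameters and the nonzero
  values of the signal; that it has no information on the support is the equivariance condition.\<close>

definition is_decoder ::
  "nat \<Rightarrow> nat \<Rightarrow> nat \<Rightarrow> ((nat \<Rightarrow> complex) \<Rightarrow> (nat \<times> nat \<Rightarrow> complex) \<Rightarrow> nat set) \<Rightarrow> bool"
where
  "is_decoder N M L D \<longleftrightarrow>
     (\<lambda>(y, A). D y A) \<in>
       (\<Pi>\<^sub>M i \<in> {1..N}. borel) \<Otimes>\<^sub>M (\<Pi>\<^sub>M ij \<in> {1..N} \<times> {1..M}. borel)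
         \<rightarrow>\<^sub>M count_space {S. S \<subseteq> {1..M} \<and> card S = L} \<and>
     (\<forall>\<pi>. \<pi> permutes {1..M} \<longrightarrow>
       (\<forall>y \<in> {1..N} \<rightarrow>\<^sub>E UNIV. \<forall>A \<in> {1..N} \<times> {1..M} \<rightarrow>\<^sub>E UNIV.
          distinct_columns N M A \<longrightarrow> D y (permute_columns N M \<pi> A) = \<pi> ` D y A))"

definition successful3 :: "real \<Rightarrow> nat \<Rightarrow> (nat \<Rightarrow> complex) \<Rightarrow> nat set \<Rightarrow> bool" where
  "successful3 \<gamma> M x S \<longleftrightarrow>
     (\<Sum>k \<in> S \<inter> supp M x. (cmod (x k))\<^sup>2) > (1 - \<gamma>) * energy M x"

definition p_err_matrix ::
  "real \<Rightarrow> real \<Rightarrow> nat \<Rightarrow> nat \<Rightarrow> (nat \<Rightarrow> complex) \<Rightarrow>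
   ((nat \<Rightarrow> complex) \<Rightarrow> (nat \<times> nat \<Rightarrow> complex) \<Rightarrow> nat set) \<Rightarrow> (nat \<times> nat \<Rightarrow> complex) \<Rightarrow> real"
where
  "p_err_matrix \<gamma> \<nu> N M x D A =
     measure (gaussian_noise \<nu> N)
       {n \<in> space (gaussian_noise \<nu> N). \<not> successful3 \<gamma> M x (D (observation N M x A n) A)}"

definition p_err ::
  "real \<Rightarrow> real \<Rightarrow> nat \<Rightarrow> nat \<Rightarrow> (nat \<Rightarrow> complex) \<Rightarrow>
   ((nat \<Rightarrow> complex) \<Rightarrow> (nat \<times> nat \<Rightarrow> complex) \<Rightarrow> nat set) \<Rightarrow> real"
where
  "p_err \<gamma> \<nu> N M x D = (\<integral>A. p_err_matrix \<gamma> \<nu> N M x D A \<partial>gaussian_matrix N M)"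

definition reliable_recovery_possible ::
  "real \<Rightarrow> real \<Rightarrow> (nat \<Rightarrow> nat) \<Rightarrow> (nat \<Rightarrow> nat \<Rightarrow> complex) \<Rightarrow> bool"
where
  "reliable_recovery_possible \<gamma> \<nu> N x \<longleftrightarrow>
     (\<exists>D. (\<forall>M\<ge>1. is_decoder (N M) M (sparsity M (x M)) (D M)) \<and>
          (\<lambda>M. p_err \<gamma> \<nu> (N M) M (x M) (D M)) \<longlonglongrightarrow> 0)"

text \<open>The functions are considered on the positive integers only.\<close>

definition dominates :: "(nat \<Rightarrow> real) \<Rightarrow> (nat \<Rightarrow> real) \<Rightarrow> bool"  (infix "\<succ>" 50) where
  "f \<succ> g \<longleftrightarrow>
     (\<forall>M\<ge>1. f M = 0 \<and> g M = 0) \<or>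
     (mono_on {1..} f \<and> mono_on {1..} g \<and> (\<forall>M\<ge>1. 0 \<le> f M \<and> 0 \<le> g M) \<and>
      (\<exists>M0. \<forall>M>M0. f M / g M > 1))"

lemma prob_space_complex_gaussian:
  assumes "v > 0"
  shows "prob_space (complex_gaussian v)"
proof -
  interpret N: prob_space "density lborel (normal_density 0 (sqrt (v / 2)))"
    using assms by (intro prob_space_normal_density) simp
  interpret P: pair_prob_space "density lborel (normal_density 0 (sqrt (v / 2)))"
    "density lborel (normal_density 0 (sqrt (v / 2)))" ..
  have "(\<lambda>(a, b). Complex a b) \<in> borel_measurable
      (density lborel (normal_density 0 (sqrt (v / 2))) \<Otimes>\<^sub>M
       density lborel (normal_density 0 (sqrt (v / 2))))"
    unfolding Complex_eq split_beta by measurable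
  then show ?thesis
    unfolding complex_gaussian_def by (rule P.prob_space_distr)
qed

end

theory Submission
  imports Defs "HOL-Library.Fun_Lexorder"
begin

text \<open>
  The decoder is the matched filter: it returns the \<open>L\<close> indices with the largest correlations
  \<open>|z\<^sub>j|\<close>, \<open>z\<^sub>j = \<Sum>\<^sub>i cnj A\<^sub>i\<^sub>j y\<^sub>i\<close>.  Suppose \<open>|z\<^sub>k| / N > |x\<^sub>k| - \<delta>\<close> on the support and
  \<open>|z\<^sub>j| / N < 2 \<delta>\<close> off it.  If \<open>k\<close> in the support is missed, then some \<open>j\<close> off the support is
  chosen instead, so \<open>|x\<^sub>k| < 3 \<delta>\<close>; with \<open>\<delta>\<^sup>2 = \<gamma> P / (9 L)\<close> the missed energy is below \<open>\<gamma> P\<close>.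
  Both bounds follow from lower bounds on \<open>Re (cnj u z\<^sub>k)\<close> for at most four phases \<open>u\<close> per index.
  These are Chernoff bounds: integrating out the noise, then the other columns, then column \<open>k\<close>
  leaves the moment generating function of \<open>|a|\<^sup>2\<close> for a standard complex Gaussian \<open>a\<close>, and each
  bound fails with probability at most \<open>exp (- N \<delta>\<^sup>2 / (12 (P + \<nu>\<^sup>2)))\<close>.  For
  \<open>N > C L log (M - L)\<close> with \<open>C\<close> large, the union bound over the \<open>4 M\<close> events tends to \<open>0\<close>.
\<close>

section \<open>Complex Gaussian integrals and the Chernoff bound\<close>

lemma borel_measurable_cnj [measurable]: "cnj \<in> borel_measurable borel"
  by (intro borel_measurable_continuous_onI continuous_intros)

definition correlation ::
  "nat \<Rightarrow> (nat \<Rightarrow> complex) \<Rightarrow> (nat \<times> nat \<Rightarrow> complex) \<Rightarrow> nat \<Rightarrow> complex" where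
  "correlation N y A j = (\<Sum>i=1..N. cnj (A (i, j)) * y i)"

lemma sets_complex_gaussian [simp, measurable_cong]: "sets (complex_gaussian v) = sets borel"
  by (simp add: complex_gaussian_def)

lemma nn_integral_normal_density:
  assumes "\<sigma> > 0"
  shows "(\<integral>\<^sup>+t. ennreal (normal_density \<mu> \<sigma> t) \<partial>lborel) = 1"
  using assms by (simp add: nn_integral_eq_integral)

text \<open>If multiplication by \<open>f\<close> turns one normal density into \<open>c\<close>
  times another, the integral is \<open>c\<close>, because the new density has mass 1. The Gaussian
  moments below thus reduce to completing the square.\<close>

lemma nn_integral_normal_scaled:
  assumes [measurable]: "f \<in> borel_measurable borel"
    and "\<sigma>' > 0" "c \<ge> 0"
    and eq: "\<And>t. normal_density \<mu> \<sigma> t * f t = c * normal_density \<mu>' \<sigma>' t"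
    and f: "\<And>t. f t \<ge> 0"
  shows "(\<integral>\<^sup>+t. ennreal (f t) \<partial>density lborel (normal_density \<mu> \<sigma>)) = ennreal c"
proof -
  have "(\<integral>\<^sup>+t. ennreal (f t) \<partial>density lborel (normal_density \<mu> \<sigma>))
      = (\<integral>\<^sup>+t. ennreal (normal_density \<mu> \<sigma> t) * ennreal (f t) \<partial>lborel)"
    by (rule nn_integral_density) auto
  also have "\<dots> = (\<integral>\<^sup>+t. ennreal c * ennreal (normal_density \<mu>' \<sigma>' t) \<partial>lborel)"
    using f \<open>c \<ge> 0\<close> by (intro nn_integral_cong) (simp add: eq flip: ennreal_mult)
  also have "\<dots> = ennreal c"
    using \<open>\<sigma>' > 0\<close> by (simp add: nn_integral_cmult nn_integral_normal_density)
  finally show ?thesis .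
qed

text \<open>An exponential tilt moves the mean to \<open>b * \<sigma>\<^sup>2\<close> and keeps the
  variance.\<close>

lemma nn_integral_exp_linear_normal:
  assumes "\<sigma> > 0"
  shows "(\<integral>\<^sup>+t. ennreal (exp (b * t)) \<partial>density lborel (normal_density 0 \<sigma>))
    = ennreal (exp (b\<^sup>2 * \<sigma>\<^sup>2 / 2))"
proof (rule nn_integral_normal_scaled[where \<mu>' = "b * \<sigma>\<^sup>2" and \<sigma>' = \<sigma>])
  fix t
  have "-(t - 0)\<^sup>2 / (2 * \<sigma>\<^sup>2) + b * t = b\<^sup>2 * \<sigma>\<^sup>2 / 2 + -(t - b * \<sigma>\<^sup>2)\<^sup>2 / (2 * \<sigma>\<^sup>2)"
    using assms by (simp add: field_simps power2_eq_square)
  then have "exp (-(t - 0)\<^sup>2 / (2 * \<sigma>\<^sup>2)) * exp (b * t)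
      = exp (b\<^sup>2 * \<sigma>\<^sup>2 / 2) * exp (-(t - b * \<sigma>\<^sup>2)\<^sup>2 / (2 * \<sigma>\<^sup>2))"
    by (simp only: flip: exp_add)
  then show "normal_density 0 \<sigma> t * exp (b * t)
      = exp (b\<^sup>2 * \<sigma>\<^sup>2 / 2) * normal_density (b * \<sigma>\<^sup>2) \<sigma> t"
    by (simp add: normal_density_def)
qed (use assms in auto)

text \<open>A quadratic tilt changes the variance from 1/2 to \<open>1 / (2 * (1 - c))\<close>,
  which is positive exactly for \<open>c < 1\<close>. Variance 1/2 is that of the real part of a
  standard complex Gaussian.\<close>

lemma nn_integral_exp_square_normal:
  assumes "c < 1"
  shows "(\<integral>\<^sup>+t. ennreal (exp (c * t\<^sup>2)) \<partial>density lborel (normal_density 0 (sqrt (1 / 2))))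
    = ennreal (1 / sqrt (1 - c))"
proof (rule nn_integral_normal_scaled[where \<mu>' = 0 and \<sigma>' = "sqrt (1 / (2 * (1 - c)))"])
  fix t :: real
  have "normal_density 0 (sqrt (1 / 2)) t * exp (c * t\<^sup>2) = 1 / sqrt pi * exp (- ((1 - c) * t\<^sup>2))"
    by (simp add: normal_density_def algebra_simps flip: exp_add)
  moreover have "normal_density 0 (sqrt (1 / (2 * (1 - c)))) t
      = 1 / sqrt (pi / (1 - c)) * exp (- ((1 - c) * t\<^sup>2))"
  proof -
    have "2 * pi * (sqrt (1 / (2 * (1 - c))))\<^sup>2 = pi / (1 - c)"
      "- (t - 0)\<^sup>2 / (2 * (sqrt (1 / (2 * (1 - c))))\<^sup>2) = - ((1 - c) * t\<^sup>2)"
      using assms by (simp_all add: field_simps)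
    then show ?thesis by (simp only: normal_density_def)
  qed
  ultimately show "normal_density 0 (sqrt (1 / 2)) t * exp (c * t\<^sup>2)
      = 1 / sqrt (1 - c) * normal_density 0 (sqrt (1 / (2 * (1 - c)))) t"
    using assms by (simp add: real_sqrt_divide)
qed (use assms in auto)

lemma nn_integral_complex_gaussian:
  assumes "v > 0" and [measurable]: "f \<in> borel_measurable borel" "g \<in> borel_measurable borel"
  shows "(\<integral>\<^sup>+z. f (Re z) * g (Im z) \<partial>complex_gaussian v)
    = (\<integral>\<^sup>+t. f t \<partial>density lborel (normal_density 0 (sqrt (v / 2))))
      * (\<integral>\<^sup>+t. g t \<partial>density lborel (normal_density 0 (sqrt (v / 2))))"
proof -
  let ?N = "density lborel (normal_density 0 (sqrt (v / 2)))"
  interpret N: prob_space ?N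
    using assms by (intro prob_space_normal_density) simp
  have [measurable]: "(\<lambda>(a, b). Complex a b) \<in> borel_measurable (?N \<Otimes>\<^sub>M ?N)"
    unfolding Complex_eq split_beta by measurable
  have "(\<integral>\<^sup>+z. f (Re z) * g (Im z) \<partial>complex_gaussian v)
      = (\<integral>\<^sup>+p. f (fst p) * g (snd p) \<partial>(?N \<Otimes>\<^sub>M ?N))"
    unfolding complex_gaussian_def by (subst nn_integral_distr) (auto simp: split_beta)
  also have "\<dots> = (\<integral>\<^sup>+a. (\<integral>\<^sup>+b. f a * g b \<partial>?N) \<partial>?N)"
    by (subst N.nn_integral_fst[symmetric]) auto
  also have "\<dots> = (\<integral>\<^sup>+t. f t \<partial>?N) * (\<integral>\<^sup>+t. g t \<partial>?N)"
    by (simp add: nn_integral_cmult nn_integral_multc)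
  finally show ?thesis .
qed

lemma nn_integral_exp_linear_complex_gaussian:
  assumes "v > 0"
  shows "(\<integral>\<^sup>+z. ennreal (exp (Re (b * z))) \<partial>complex_gaussian v) = ennreal (exp ((cmod b)\<^sup>2 * v / 4))"
proof -
  \<comment> \<open>The sign comes from
    \<open>Re (b * z) = Re b * Re z - Im b * Im z\<close>.\<close>
  define c where "c = - Im b"
  have "(\<integral>\<^sup>+z. ennreal (exp (Re (b * z))) \<partial>complex_gaussian v)
      = (\<integral>\<^sup>+z. ennreal (exp (Re b * Re z)) * ennreal (exp (c * Im z)) \<partial>complex_gaussian v)"
    by (intro nn_integral_cong) (simp add: c_def flip: ennreal_mult exp_add)
  also have "\<dots> = ennreal (exp ((Re b)\<^sup>2 * (sqrt (v / 2))\<^sup>2 / 2))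
      * ennreal (exp (c\<^sup>2 * (sqrt (v / 2))\<^sup>2 / 2))"
    using assms by (subst nn_integral_complex_gaussian[where f = "\<lambda>t. ennreal (exp (Re b * t))"
          and g = "\<lambda>t. ennreal (exp (c * t))"])
      (simp_all add: nn_integral_exp_linear_normal)
  also have "\<dots> = ennreal (exp ((cmod b)\<^sup>2 * v / 4))"
    using assms by (simp add: c_def cmod_power2 field_simps flip: ennreal_mult exp_add)
  finally show ?thesis .
qed

lemma nn_integral_exp_square_complex_gaussian:
  assumes "c < 1"
  shows "(\<integral>\<^sup>+z. ennreal (exp (c * (cmod z)\<^sup>2)) \<partial>complex_gaussian 1) = ennreal (1 / (1 - c))"
proof -
  have "(\<integral>\<^sup>+z. ennreal (exp (c * (cmod z)\<^sup>2)) \<partial>complex_gaussian 1)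
      = (\<integral>\<^sup>+z. ennreal (exp (c * (Re z)\<^sup>2)) * ennreal (exp (c * (Im z)\<^sup>2)) \<partial>complex_gaussian 1)"
    by (intro nn_integral_cong) (simp add: cmod_power2 distrib_left flip: ennreal_mult exp_add)
  also have "\<dots> = ennreal (1 / sqrt (1 - c)) * ennreal (1 / sqrt (1 - c))"
    using assms by (subst nn_integral_complex_gaussian[where f = "\<lambda>t. ennreal (exp (c * t\<^sup>2))"
          and g = "\<lambda>t. ennreal (exp (c * t\<^sup>2))"])
      (simp_all only: nn_integral_exp_square_normal, simp_all)
  also have "\<dots> = ennreal (1 / (1 - c))"
    using assms by (simp flip: ennreal_mult)
  finally show ?thesis .
qed

text \<open>Second-order expansion of \<open>- ln (1 - c)\<close>. The remainder
  \<open>2 * c\<^sup>2\<close> becomes part of the quadratic term of the Chernoff exponent.\<close>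

lemma nn_integral_exp_square_complex_gaussian_le:
  assumes "\<bar>c\<bar> \<le> 1 / 2"
  shows "(\<integral>\<^sup>+z. ennreal (exp (c * (cmod z)\<^sup>2)) \<partial>complex_gaussian 1) \<le> ennreal (exp (c + 2 * c\<^sup>2))"
proof -
  have "\<bar>ln (1 + - c) - - c\<bar> \<le> 2 * (- c)\<^sup>2"
    using assms by (intro abs_ln_one_plus_x_minus_x_bound) simp
  then have "- ln (1 - c) \<le> c + 2 * c\<^sup>2" by (simp add: abs_le_iff)
  then have "exp (- ln (1 - c)) \<le> exp (c + 2 * c\<^sup>2)" by simp
  moreover have "exp (- ln (1 - c)) = 1 / (1 - c)"
    using assms by (simp add: exp_minus inverse_eq_divide)
  ultimately show ?thesis
    using assms by (simp add: nn_integral_exp_square_complex_gaussian)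
qed

text \<open>Given the matrix, the logarithm of the moment generating function at \<open>s\<close> of
  \<open>- Re (cnj u z\<^sub>k)\<close>.\<close>

definition cond_log_mgf ::
  "real \<Rightarrow> nat \<Rightarrow> nat \<Rightarrow> (nat \<Rightarrow> complex) \<Rightarrow> nat \<Rightarrow> complex \<Rightarrow> real \<Rightarrow> (nat \<times> nat \<Rightarrow> complex) \<Rightarrow> real" where
  "cond_log_mgf \<nu> N M x k u s A =
     - s * Re (cnj u * (\<Sum>i=1..N. cnj (A (i, k)) * (\<Sum>j=1..M. A (i, j) * x j)))
     + (\<Sum>i=1..N. s\<^sup>2 * \<nu>\<^sup>2 / 4 * (cmod (A (i, k)))\<^sup>2)"

text \<open>Chernoff's method for a fixed matrix: the indicator of the lower tail is at most the
  exponential of \<open>s\<close> times the distance below \<tau>. The noise entry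
  \<open>n i\<close> enters linearly with a coefficient of modulus \<open>cmod (A (i, k))\<close>,
  so the integral factorises over the rows into exponential moments of single Gaussians.\<close>

lemma measure_correlation_observation_le:
  assumes "\<nu> > 0" "cmod u = 1" "s \<ge> 0"
  shows "measure (gaussian_noise \<nu> N)
      {n \<in> space (gaussian_noise \<nu> N). Re (cnj u * correlation N (observation N M x A n) A k) \<le> \<tau>}
    \<le> exp (s * \<tau> + cond_log_mgf \<nu> N M x k u s A)"
    (is "measure ?G ?E \<le> _")
proof -
  interpret product_prob_space "\<lambda>_. complex_gaussian (\<nu>\<^sup>2)" "{1..N}"
    using prob_space_complex_gaussian[of "\<nu>\<^sup>2"] assms
    by (simp add: product_prob_space_def product_prob_space_axioms_def product_sigma_finite_def
        prob_space_imp_sigma_finite)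
  have corr: "Re (cnj u * correlation N (observation N M x A n) A k)
      = Re (cnj u * (\<Sum>i=1..N. cnj (A (i, k)) * (\<Sum>j=1..M. A (i, j) * x j)))
        + (\<Sum>i=1..N. Re (cnj u * cnj (A (i, k)) * n i))" for n
    unfolding Re_sum[symmetric] plus_complex.sel[symmetric]
    by (simp add: correlation_def observation_def distrib_left sum.distrib sum_distrib_left mult.assoc
        del: plus_complex.sel times_complex.sel)
  define K where "K = s * \<tau> - s * Re (cnj u * (\<Sum>i=1..N. cnj (A (i, k)) * (\<Sum>j=1..M. A (i, j) * x j)))"
  define b where "b i = cnj u * cnj (A (i, k))" for i
  define R where "R n = (\<Sum>i=1..N. Re (b i * n i))" for n
  have cmod_b: "cmod (b i) = cmod (A (i, k))" for i
    using assms by (simp add: b_def norm_mult)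
  have "emeasure ?G ?E = (\<integral>\<^sup>+n. indicator ?E n \<partial>?G)"
    unfolding gaussian_noise_def corr by (subst nn_integral_indicator) auto
  also have "\<dots> \<le> (\<integral>\<^sup>+n. ennreal (exp K) * (\<Prod>i\<in>{1..N}. ennreal (exp (Re (- of_real s * b i * n i)))) \<partial>?G)"
  proof (intro nn_integral_mono)
    fix n
    have "Re (- of_real s * b i * n i) = - s * Re (b i * n i)" for i
      by (simp add: algebra_simps)
    then have "(\<Prod>i\<in>{1..N}. exp (Re (- of_real s * b i * n i))) = exp (- s * R n)"
      unfolding R_def by (simp only: sum_distrib_left finite_atLeastAtMost flip: exp_sum)
    then have *: "ennreal (exp K) * (\<Prod>i\<in>{1..N}. ennreal (exp (Re (- of_real s * b i * n i))))
        = ennreal (exp (K - s * R n))"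
      by (simp only: prod_ennreal exp_ge_zero flip: ennreal_mult exp_add) simp
    \<comment> \<open>\<open>K\<close> is the noise-free part of the exponent and \<open>R n\<close>
      the noise part of the tested correlation. The exponent is nonnegative on the event, so its
      exponential is at least 1 there.\<close>
    have "0 \<le> K - s * R n" if "n \<in> ?E"
      using that \<open>s \<ge> 0\<close> unfolding corr b_def[symmetric] R_def[symmetric] K_def
      by (simp del: Re_sum times_complex.sel flip: right_diff_distrib)
    then show "indicator ?E n \<le> ennreal (exp K)
        * (\<Prod>i\<in>{1..N}. ennreal (exp (Re (- of_real s * b i * n i))))"
      unfolding * by (simp add: indicator_def del: ennreal_1 flip: ennreal_1)
  qed
  also have "\<dots> = ennreal (exp K) * (\<Prod>i\<in>{1..N}. ennreal (exp ((cmod (- of_real s * b i))\<^sup>2 * \<nu>\<^sup>2 / 4)))"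
    unfolding gaussian_noise_def
    using assms
    by (subst nn_integral_cmult, measurable, subst product_nn_integral_prod)
      (simp_all only: nn_integral_exp_linear_complex_gaussian zero_less_power finite_atLeastAtMost, measurable)
  also have "\<dots> = ennreal (exp (K + (\<Sum>i=1..N. s\<^sup>2 * \<nu>\<^sup>2 / 4 * (cmod (A (i, k)))\<^sup>2)))"
    by (simp add: prod_ennreal prod_nonneg norm_mult cmod_b power_mult_distrib exp_add exp_sum mult_ac
        flip: ennreal_mult)
  also have "K + (\<Sum>i=1..N. s\<^sup>2 * \<nu>\<^sup>2 / 4 * (cmod (A (i, k)))\<^sup>2) = s * \<tau> + cond_log_mgf \<nu> N M x k u s A"
    by (simp only: K_def cond_log_mgf_def algebra_simps)
  finally have "emeasure ?G ?E \<le> ennreal (exp (s * \<tau> + cond_log_mgf \<nu> N M x k u s A))" .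
  then show ?thesis
    unfolding measure_def by (intro enn2real_leI exp_ge_zero)
qed

section \<open>Averaging the conditional moment generating function over the Gaussian matrix\<close>

lemma quadratic_perturbation_bounds:
  fixes a b r :: real
  assumes "\<bar>a\<bar> \<le> r" "0 \<le> b" "b \<le> r\<^sup>2 / 4" "r \<le> 1 / 4"
  shows "\<bar>b - a\<bar> \<le> 1 / 2" and "(b - a) + 2 * (b - a)\<^sup>2 \<le> - a + 3 * r\<^sup>2"
proof -
  have r: "0 \<le> r" using assms by linarith
  \<comment> \<open>This gives \<open>b \<le> r / 16\<close>, whence the factor 17/16. Its square is
    at most 11/8, and 2 * 11/8 + 1/4 = 3 is the constant of the second bound.\<close>
  then have "r\<^sup>2 \<le> 1 / 4 * r"
    using assms unfolding power2_eq_square by (intro mult_right_mono) auto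
  with assms have *: "\<bar>b - a\<bar> \<le> 17 / 16 * r" by linarith
  with assms show "\<bar>b - a\<bar> \<le> 1 / 2" by linarith
  have "(b - a)\<^sup>2 \<le> (17 / 16 * r)\<^sup>2"
    using * r by (simp add: abs_le_square_iff[symmetric])
  also have "\<dots> \<le> 11 / 8 * r\<^sup>2"
    by (simp add: power_mult_distrib power2_eq_square mult_right_mono)
  finally show "(b - a) + 2 * (b - a)\<^sup>2 \<le> - a + 3 * r\<^sup>2"
    using assms by linarith
qed

lemma borel_measurable_cond_log_mgf:
  assumes "k \<in> {1..M}"
  shows "cond_log_mgf \<nu> N M x k u s \<in> borel_measurable (gaussian_matrix N M)"
proof -
  have [measurable]: "(\<lambda>A. A (i, j)) \<in> borel_measurable (gaussian_matrix N M)"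
    if "i \<in> {1..N}" "j \<in> {1..M}" for i j
    using that measurable_component_singleton[of "(i, j)" "{1..N} \<times> {1..M}" "\<lambda>_. complex_gaussian 1"]
    by (auto simp: gaussian_matrix_def cong: measurable_cong_sets)
  show ?thesis
    using assms unfolding cond_log_mgf_def by measurable
qed

text \<open>Tonelli, with the entries outside column \<open>k\<close> integrated first. Given column
  \<open>k\<close> the exponent is linear in them, so the interference contributes
  \<open>s\<^sup>2 * c / 4\<close> times the squared norm of that column. What remains is a product
  over the rows of \<open>exp (t * (cmod (a p))\<^sup>2)\<close>, and the smallness of
  \<open>s\<close> keeps \<open>t\<close> within the range of the second-order bound.\<close>

lemma nn_integral_exp_cond_log_mgf_le:
  assumes "k \<in> {1..M}" "cmod u = 1" "\<nu> > 0" "s \<ge> 0"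
    and s: "s\<^sup>2 * (energy M x + \<nu>\<^sup>2) \<le> 1 / 16"
  shows "(\<integral>\<^sup>+A. ennreal (exp (cond_log_mgf \<nu> N M x k u s A)) \<partial>gaussian_matrix N M)
    \<le> ennreal (exp (real N * (- s * Re (cnj u * x k) + 3 * s\<^sup>2 * (energy M x + \<nu>\<^sup>2))))"
    (is "(\<integral>\<^sup>+A. ennreal (exp (?E A)) \<partial>_) \<le> _")
proof -
  interpret prob_space "complex_gaussian 1"
    by (rule prob_space_complex_gaussian) simp
  interpret product_prob_space "\<lambda>_. complex_gaussian 1" I for I
    by standard
  define I where "I = {1..N} \<times> {k}"
  define J where "J = {1..N} \<times> ({1..M} - {k})"
  define \<xi> where "\<xi> = Re (cnj u * x k)"
  define S where "S = energy M x + \<nu>\<^sup>2"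
  define c where "c = (\<Sum>j\<in>{1..M} - {k}. (cmod (x j))\<^sup>2)"
  define t where "t = s\<^sup>2 * (c + \<nu>\<^sup>2) / 4 - s * \<xi>"
  define \<beta> where "\<beta> a p = - of_real s * cnj u * cnj (a (fst p, k)) * x (snd p)"
    for a :: "nat \<times> nat \<Rightarrow> complex" and p :: "nat \<times> nat"
  have IJ: "I \<inter> J = {}" "finite I" "finite J" "I \<union> J = {1..N} \<times> {1..M}"
    using assms by (auto simp: I_def J_def)
  have energy: "energy M x = (cmod (x k))\<^sup>2 + c"
    unfolding energy_def c_def using assms by (simp add: sum.remove)
  \<comment> \<open>The term \<open>j = k\<close> of the inner sum yields
    \<open>(cmod (A (i, k)))\<^sup>2 * x k\<close>. Every other term is linear in an entry of
    \<open>J\<close>, with a coefficient \<open>\<beta> A p\<close> that reads only column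
    \<open>k\<close>, so it is constant in the inner integral.\<close>
  have exponent: "?E A = (\<Sum>p\<in>I. (s\<^sup>2 * \<nu>\<^sup>2 / 4 - s * \<xi>) * (cmod (A p))\<^sup>2) + (\<Sum>p\<in>J. Re (\<beta> A p * A p))" for A
  proof -
    have "cnj (A (i, k)) * (\<Sum>j=1..M. A (i, j) * x j)
        = of_real ((cmod (A (i, k)))\<^sup>2) * x k + (\<Sum>j\<in>{1..M} - {k}. cnj (A (i, k)) * x j * A (i, j))" for i
    proof -
      have "(\<Sum>j=1..M. A (i, j) * x j) = A (i, k) * x k + (\<Sum>j\<in>{1..M} - {k}. A (i, j) * x j)"
        using assms by (simp add: sum.remove)
      then show ?thesis
        by (simp only: distrib_left sum_distrib_left complex_norm_square) (simp add: mult_ac)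
    qed
    then have "- s * Re (cnj u * (\<Sum>i=1..N. cnj (A (i, k)) * (\<Sum>j=1..M. A (i, j) * x j)))
        = (\<Sum>i=1..N. - s * Re (cnj u * (of_real ((cmod (A (i, k)))\<^sup>2) * x k))
            + (\<Sum>j\<in>{1..M} - {k}. - s * Re (cnj u * (cnj (A (i, k)) * x j * A (i, j)))))"
      by (simp only: sum_distrib_left distrib_left Re_sum plus_complex.sel)
    also have "\<dots> = (\<Sum>i=1..N. - s * \<xi> * (cmod (A (i, k)))\<^sup>2
        + (\<Sum>j\<in>{1..M} - {k}. Re (\<beta> A (i, j) * A (i, j))))"
      by (intro sum.cong refl arg_cong2[where f = "(+)"]) (simp_all add: \<beta>_def \<xi>_def algebra_simps)
    also have "\<dots> = (\<Sum>i=1..N. - s * \<xi> * (cmod (A (i, k)))\<^sup>2) + (\<Sum>p\<in>J. Re (\<beta> A p * A p))"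
      by (simp only: J_def sum.distrib sum.cartesian_product')
    finally show ?thesis
      by (simp add: cond_log_mgf_def I_def sum.cartesian_product' sum.distrib left_diff_distrib sum_subtractf sum_negf)
  qed
  have row: "(\<Sum>p\<in>J. (cmod (\<beta> a p))\<^sup>2 * 1 / 4) = (\<Sum>p\<in>I. s\<^sup>2 * c / 4 * (cmod (a p))\<^sup>2)" for a
    using assms
    by (simp add: I_def J_def \<beta>_def norm_mult power_mult_distrib sum.cartesian_product' c_def
        sum_distrib_left sum_distrib_right mult_ac sum_divide_distrib)
  have E: "(\<lambda>A. ennreal (exp (?E A))) \<in> borel_measurable (Pi\<^sub>M (I \<union> J) (\<lambda>_. complex_gaussian 1))"
    using borel_measurable_cond_log_mgf[OF assms(1)] unfolding IJ(4) gaussian_matrix_def by measurable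
  have "(\<integral>\<^sup>+A. ennreal (exp (?E A)) \<partial>gaussian_matrix N M)
      = (\<integral>\<^sup>+a. (\<integral>\<^sup>+b. ennreal (exp (?E (merge I J (a, b))))
          \<partial>Pi\<^sub>M J (\<lambda>_. complex_gaussian 1)) \<partial>Pi\<^sub>M I (\<lambda>_. complex_gaussian 1))"
    unfolding gaussian_matrix_def IJ(4)[symmetric]
    by (intro product_nn_integral_fold IJ E)
  also have "\<dots> = (\<integral>\<^sup>+a. ennreal (exp (\<Sum>p\<in>I. (s\<^sup>2 * \<nu>\<^sup>2 / 4 - s * \<xi>) * (cmod (a p))\<^sup>2))
          * (\<integral>\<^sup>+b. (\<Prod>p\<in>J. ennreal (exp (Re (\<beta> a p * b p)))) \<partial>Pi\<^sub>M J (\<lambda>_. complex_gaussian 1))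
        \<partial>Pi\<^sub>M I (\<lambda>_. complex_gaussian 1))"
  proof (intro nn_integral_cong, subst nn_integral_cmult[symmetric])
    fix a :: "nat \<times> nat \<Rightarrow> complex"
    show "(\<lambda>b. \<Prod>p\<in>J. ennreal (exp (Re (\<beta> a p * b p)))) \<in> borel_measurable (Pi\<^sub>M J (\<lambda>_. complex_gaussian 1))"
      by measurable
  next
    fix a :: "nat \<times> nat \<Rightarrow> complex"
    show "(\<integral>\<^sup>+b. ennreal (exp (?E (merge I J (a, b)))) \<partial>Pi\<^sub>M J (\<lambda>_. complex_gaussian 1))
      = (\<integral>\<^sup>+b. ennreal (exp (\<Sum>p\<in>I. (s\<^sup>2 * \<nu>\<^sup>2 / 4 - s * \<xi>) * (cmod (a p))\<^sup>2))
          * (\<Prod>p\<in>J. ennreal (exp (Re (\<beta> a p * b p)))) \<partial>Pi\<^sub>M J (\<lambda>_. complex_gaussian 1))"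
    proof (intro nn_integral_cong)
      fix b :: "nat \<times> nat \<Rightarrow> complex"
      have "merge I J (a, b) p = a p" if "p \<in> I" for p
        using that by (simp add: merge_def)
      moreover have "merge I J (a, b) p = b p" "\<beta> (merge I J (a, b)) p = \<beta> a p" if "p \<in> J" for p
        using that by (auto simp: merge_def \<beta>_def I_def J_def)
      ultimately show "ennreal (exp (?E (merge I J (a, b))))
          = ennreal (exp (\<Sum>p\<in>I. (s\<^sup>2 * \<nu>\<^sup>2 / 4 - s * \<xi>) * (cmod (a p))\<^sup>2))
            * (\<Prod>p\<in>J. ennreal (exp (Re (\<beta> a p * b p))))"
        unfolding exponent
        by (simp add: exp_add exp_sum IJ prod_ennreal prod_nonneg ennreal_mult del: times_complex.sel)
    qed
  qed
  also have "\<dots> = (\<integral>\<^sup>+a. (\<Prod>p\<in>I. ennreal (exp (t * (cmod (a p))\<^sup>2))) \<partial>Pi\<^sub>M I (\<lambda>_. complex_gaussian 1))"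
  proof (intro nn_integral_cong)
    fix a :: "nat \<times> nat \<Rightarrow> complex"
    have "(\<integral>\<^sup>+b. (\<Prod>p\<in>J. ennreal (exp (Re (\<beta> a p * b p)))) \<partial>Pi\<^sub>M J (\<lambda>_. complex_gaussian 1))
        = (\<Prod>p\<in>J. ennreal (exp ((cmod (\<beta> a p))\<^sup>2 * 1 / 4)))"
      by (subst product_nn_integral_prod)
        (simp_all only: IJ nn_integral_exp_linear_complex_gaussian zero_less_one, measurable)
    also have "\<dots> = ennreal (exp (\<Sum>p\<in>I. s\<^sup>2 * c / 4 * (cmod (a p))\<^sup>2))"
      unfolding row[symmetric] by (simp add: prod_ennreal exp_sum IJ)
    finally have "ennreal (exp (\<Sum>p\<in>I. (s\<^sup>2 * \<nu>\<^sup>2 / 4 - s * \<xi>) * (cmod (a p))\<^sup>2))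
          * (\<integral>\<^sup>+b. (\<Prod>p\<in>J. ennreal (exp (Re (\<beta> a p * b p)))) \<partial>Pi\<^sub>M J (\<lambda>_. complex_gaussian 1))
        = ennreal (exp ((\<Sum>p\<in>I. (s\<^sup>2 * \<nu>\<^sup>2 / 4 - s * \<xi>) * (cmod (a p))\<^sup>2)
            + (\<Sum>p\<in>I. s\<^sup>2 * c / 4 * (cmod (a p))\<^sup>2)))"
      by (simp add: exp_add ennreal_mult)
    also have "(\<Sum>p\<in>I. (s\<^sup>2 * \<nu>\<^sup>2 / 4 - s * \<xi>) * (cmod (a p))\<^sup>2)
          + (\<Sum>p\<in>I. s\<^sup>2 * c / 4 * (cmod (a p))\<^sup>2) = (\<Sum>p\<in>I. t * (cmod (a p))\<^sup>2)"
      unfolding sum.distrib[symmetric] t_def by (intro sum.cong) (auto simp: field_simps)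
    also have "ennreal (exp \<dots>) = (\<Prod>p\<in>I. ennreal (exp (t * (cmod (a p))\<^sup>2)))"
      by (simp add: prod_ennreal exp_sum IJ)
    finally show "ennreal (exp (\<Sum>p\<in>I. (s\<^sup>2 * \<nu>\<^sup>2 / 4 - s * \<xi>) * (cmod (a p))\<^sup>2))
          * (\<integral>\<^sup>+b. (\<Prod>p\<in>J. ennreal (exp (Re (\<beta> a p * b p)))) \<partial>Pi\<^sub>M J (\<lambda>_. complex_gaussian 1))
        = (\<Prod>p\<in>I. ennreal (exp (t * (cmod (a p))\<^sup>2)))" .
  qed
  also have "\<dots> = (\<Prod>p\<in>I. \<integral>\<^sup>+z. ennreal (exp (t * (cmod z)\<^sup>2)) \<partial>complex_gaussian 1)"
    by (subst product_nn_integral_prod) (simp_all add: IJ)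
  also have "\<dots> \<le> (\<Prod>p\<in>I. ennreal (exp (- s * \<xi> + 3 * s\<^sup>2 * S)))"
  proof (rule prod_mono_ennreal)
    \<comment> \<open>The perturbation bounds are applied with \<open>r = s * sqrt S\<close>: the
      signal part satisfies \<open>\<bar>\<xi>\<bar> \<le> sqrt S\<close>, the variance part
      \<open>c + \<nu>\<^sup>2 \<le> S\<close>, and the hypothesis on \<open>s\<close> says
      \<open>r \<le> 1 / 4\<close>.\<close>
    have S: "0 \<le> S" "(cmod (x k))\<^sup>2 \<le> S" "0 \<le> c" "c + \<nu>\<^sup>2 \<le> S"
      using energy by (auto simp: S_def c_def sum_nonneg)
    have "\<bar>\<xi>\<bar> \<le> cmod (x k)"
      using abs_Re_le_cmod[of "cnj u * x k"] assms by (simp add: \<xi>_def norm_mult)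
    also have "\<dots> \<le> sqrt S"
      using S by (simp add: real_le_rsqrt)
    finally have "\<bar>s * \<xi>\<bar> \<le> s * sqrt S"
      using assms by (simp add: abs_mult mult_left_mono)
    moreover have "s * sqrt S \<le> 1 / 4"
    proof (rule power2_le_imp_le)
      show "(s * sqrt S)\<^sup>2 \<le> (1 / 4)\<^sup>2"
        using s S by (simp add: power_mult_distrib S_def power_divide)
    qed simp
    moreover have "s\<^sup>2 * (c + \<nu>\<^sup>2) / 4 \<le> (s * sqrt S)\<^sup>2 / 4"
      using S by (simp add: power_mult_distrib mult_left_mono)
    moreover have "0 \<le> s\<^sup>2 * (c + \<nu>\<^sup>2) / 4"
      using S by simp
    ultimately have t: "\<bar>t\<bar> \<le> 1 / 2" "t + 2 * t\<^sup>2 \<le> - (s * \<xi>) + 3 * (s * sqrt S)\<^sup>2"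
      unfolding t_def
      using quadratic_perturbation_bounds[of "s * \<xi>" "s * sqrt S" "s\<^sup>2 * (c + \<nu>\<^sup>2) / 4"] by blast+
    have "(\<integral>\<^sup>+z. ennreal (exp (t * (cmod z)\<^sup>2)) \<partial>complex_gaussian 1) \<le> ennreal (exp (t + 2 * t\<^sup>2))"
      by (rule nn_integral_exp_square_complex_gaussian_le) fact
    also have "\<dots> \<le> ennreal (exp (- s * \<xi> + 3 * s\<^sup>2 * S))"
      using t(2) S by (simp add: power_mult_distrib)
    finally show "(\<integral>\<^sup>+z. ennreal (exp (t * (cmod z)\<^sup>2)) \<partial>complex_gaussian 1)
        \<le> ennreal (exp (- s * \<xi> + 3 * s\<^sup>2 * S))" .
  qed
  also have "\<dots> = ennreal (exp (real N * (- s * \<xi> + 3 * s\<^sup>2 * S)))"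
    by (simp add: I_def ennreal_power flip: exp_of_nat_mult)
  finally show ?thesis
    unfolding \<xi>_def S_def .
qed

section \<open>The matched filter decoder\<close>

definition top_set :: "('a \<Rightarrow> 'a \<Rightarrow> bool) \<Rightarrow> 'a set \<Rightarrow> nat \<Rightarrow> 'a set" where
  "top_set lt S L = {j \<in> S. card {k \<in> S. lt j k} < L}"

text \<open>The rank of an element counts the elements above it. In a strict linear order ranks are
  distinct and below \<open>card S\<close>, hence run through all of \<open>{..<card S}\<close>. So
  exactly \<open>L\<close> ranks lie below \<open>L\<close>, and a smaller rank means a greater
  element.\<close>

lemma
  assumes "finite S" "L \<le> card S"
    and irrefl: "\<And>j. j \<in> S \<Longrightarrow> \<not> lt j j"
    and trans: "\<And>i j k. i \<in> S \<Longrightarrow> j \<in> S \<Longrightarrow> k \<in> S \<Longrightarrow> lt i j \<Longrightarrow> lt j k \<Longrightarrow> lt i k"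
    and total: "\<And>j k. j \<in> S \<Longrightarrow> k \<in> S \<Longrightarrow> j \<noteq> k \<Longrightarrow> lt j k \<or> lt k j"
  shows card_top_set: "card (top_set lt S L) = L"
    and top_set_greatest: "j \<in> top_set lt S L \<Longrightarrow> k \<in> S - top_set lt S L \<Longrightarrow> lt k j"
proof -
  define rank where "rank j = card {k \<in> S. lt j k}" for j
  have mono: "rank k < rank j" if "j \<in> S" "k \<in> S" "lt j k" for j k
  proof -
    have "{i \<in> S. lt k i} \<subseteq> {i \<in> S. lt j i}"
      using trans[of j k] that by blast
    moreover have "k \<in> {i \<in> S. lt j i}" "k \<notin> {i \<in> S. lt k i}"
      using that irrefl by auto
    ultimately show ?thesis
      unfolding rank_def using assms(1) by (intro psubset_card_mono) (simp, blast)
  qed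
  have "inj_on rank S"
  proof (rule inj_onI)
    fix j k assume "j \<in> S" "k \<in> S" "rank j = rank k"
    then show "j = k"
      using total[of j k] mono[of j k] mono[of k j] by auto
  qed
  moreover have "rank j < card S" if "j \<in> S" for j
  proof -
    have "{k \<in> S. lt j k} \<subset> S"
      using that irrefl by blast
    then show ?thesis
      unfolding rank_def using assms(1) by (rule psubset_card_mono[rotated])
  qed
  ultimately have bij: "bij_betw rank S {..<card S}"
    unfolding bij_betw_def using assms(1)
    by (metis card_image card_lessThan card_subset_eq finite_lessThan image_subsetI lessThan_iff)
  have "rank ` top_set lt S L = {..<L}"
  proof
    show "rank ` top_set lt S L \<subseteq> {..<L}"
      by (auto simp: top_set_def rank_def)
    show "{..<L} \<subseteq> rank ` top_set lt S L"
    proof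
      fix r assume r: "r \<in> {..<L}"
      then obtain j where "j \<in> S" "rank j = r"
        using bij assms(2) unfolding bij_betw_def by (metis imageE lessThan_iff order_less_le_trans)
      then show "r \<in> rank ` top_set lt S L"
        using r by (auto simp: top_set_def rank_def)
    qed
  qed
  moreover have "inj_on rank (top_set lt S L)"
    using bij unfolding bij_betw_def by (elim conjE inj_on_subset) (auto simp: top_set_def)
  ultimately show "card (top_set lt S L) = L"
    by (metis card_image card_lessThan)
  assume j: "j \<in> top_set lt S L" and k: "k \<in> S - top_set lt S L"
  then have "rank j < rank k" "j \<noteq> k" "j \<in> S" "k \<in> S"
    by (auto simp: top_set_def rank_def)
  then show "lt k j"
    using total[of j k] mono[of j k] by auto
qed

text \<open>An order-preserving renaming preserves ranks. This is the source of the equivariance of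
  the decoder.\<close>

lemma top_set_image:
  assumes "inj_on \<pi> S" "\<And>j k. j \<in> S \<Longrightarrow> k \<in> S \<Longrightarrow> lt' (\<pi> j) (\<pi> k) \<longleftrightarrow> lt j k"
  shows "top_set lt' (\<pi> ` S) L = \<pi> ` top_set lt S L"
proof -
  have "card {k \<in> \<pi> ` S. lt' (\<pi> j) k} = card {k \<in> S. lt j k}" if "j \<in> S" for j
  proof -
    have "{k \<in> \<pi> ` S. lt' (\<pi> j) k} = \<pi> ` {k \<in> S. lt j k}"
      using that assms(2) by auto
    then show ?thesis
      using assms(1) by (simp add: card_image inj_on_subset)
  qed
  then show ?thesis
    by (auto simp: top_set_def)
qed

text \<open>The entries of the column break ties between equal correlations in a way that commutes with
  permutations of distinct columns; the last coordinate only matters for repeated columns.\<close>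

definition column_key :: "nat \<Rightarrow> (nat \<Rightarrow> complex) \<Rightarrow> (nat \<times> nat \<Rightarrow> complex) \<Rightarrow> nat \<Rightarrow> nat \<Rightarrow> real" where
  "column_key N y A j m =
     (if m = 0 then cmod (correlation N y A j)
      else if m \<le> N then Re (A (m, j))
      else if m \<le> 2 * N then Im (A (m - N, j))
      else if m = 2 * N + 1 then real j else 0)"

text \<open>\<open>less_fun\<close> is the lexicographic comparison, so the correlations decide
  first and the later coordinates only settle ties. Selecting by counts rather than by sorting makes
  equivariance and measurability direct.\<close>

definition matched_filter ::
  "nat \<Rightarrow> nat \<Rightarrow> nat \<Rightarrow> (nat \<Rightarrow> complex) \<Rightarrow> (nat \<times> nat \<Rightarrow> complex) \<Rightarrow> nat set" where
  "matched_filter N M L y A =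
     top_set (\<lambda>j k. less_fun (column_key N y A j) (column_key N y A k)) {1..M} L"

text \<open>Trichotomy of \<open>less_fun\<close> asks for finitely many differing coordinates: keys
  vanish beyond \<open>2 * N + 1\<close>, and that last coordinate separates any two
  indices.\<close>

lemma less_fun_column_key_total:
  assumes "j \<noteq> k"
  shows "less_fun (column_key N y A j) (column_key N y A k)
    \<or> less_fun (column_key N y A k) (column_key N y A j)"
proof -
  have "column_key N y A j (2 * N + 1) \<noteq> column_key N y A k (2 * N + 1)"
    using assms by (simp add: column_key_def)
  moreover have "finite {m. column_key N y A j m \<noteq> column_key N y A k m}"
    by (rule finite_subset[of _ "{..2 * N + 1}"]) (auto simp: column_key_def split: if_splits)
  ultimately show ?thesis
    using less_fun_trichotomy by metis
qed

text \<open>The first difference occurs no later than any known difference \<open>m0\<close>, so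
  later coordinates cannot matter. This removes the index coordinate, which is not equivariant, from
  comparisons of distinct columns.\<close>

lemma less_fun_cong:
  fixes f g f' g' :: "'a :: linorder \<Rightarrow> 'b :: linorder"
  assumes "f m0 \<noteq> g m0" "\<And>m. m \<le> m0 \<Longrightarrow> f m = f' m" "\<And>m. m \<le> m0 \<Longrightarrow> g m = g' m"
  shows "less_fun f g \<longleftrightarrow> less_fun f' g'"
proof -
  have imp: "less_fun f' g'" if *: "less_fun f g" "f m0 \<noteq> g m0"
    "\<And>m. m \<le> m0 \<Longrightarrow> f m = f' m" "\<And>m. m \<le> m0 \<Longrightarrow> g m = g' m"
    for f g f' g' :: "'a \<Rightarrow> 'b"
  proof -
    obtain m where m: "f m < g m" "\<And>m'. m' < m \<Longrightarrow> f m' = g m'"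
      using *(1) unfolding less_fun_def by blast
    with *(2) have le: "m \<le> m0" by (meson not_le)
    show ?thesis
      using m le *(3,4) by (intro less_funI exI[of _ m]) (metis less_imp_le order_trans)
  qed
  have neq: "f' m0 \<noteq> g' m0"
    using assms(1) assms(2)[of m0] assms(3)[of m0] by simp
  show ?thesis
    using imp[of f g f' g', OF _ assms] imp[of f' g' f g, OF _ neq assms(2,3)[symmetric]] by blast
qed

lemma
  assumes "L \<le> M"
  shows matched_filter_subset: "matched_filter N M L y A \<subseteq> {1..M}"
    and card_matched_filter: "card (matched_filter N M L y A) = L"
    and matched_filter_le: "j \<in> matched_filter N M L y A \<Longrightarrow> k \<in> {1..M} - matched_filter N M L y A
      \<Longrightarrow> cmod (correlation N y A k) \<le> cmod (correlation N y A j)"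
proof -
  let ?lt = "\<lambda>j k. less_fun (column_key N y A j) (column_key N y A k)"
  show "matched_filter N M L y A \<subseteq> {1..M}"
    by (auto simp: matched_filter_def top_set_def)
  have order: "finite {1..M}" "L \<le> card {1..M}" "\<And>j. \<not> ?lt j j"
    "\<And>i j k. ?lt i j \<Longrightarrow> ?lt j k \<Longrightarrow> ?lt i k" "\<And>j k. j \<noteq> k \<Longrightarrow> ?lt j k \<or> ?lt k j"
    using assms less_fun_irrefl less_fun_trans less_fun_column_key_total by (simp, simp, blast+)
  show "card (matched_filter N M L y A) = L"
    unfolding matched_filter_def by (rule card_top_set[OF order])
  assume "j \<in> matched_filter N M L y A" "k \<in> {1..M} - matched_filter N M L y A"
  then have "?lt k j"
    unfolding matched_filter_def by - (rule top_set_greatest[of "{1..M}" L ?lt, OF order])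
  then obtain m where m: "column_key N y A k m < column_key N y A j m"
      "\<And>m'. m' < m \<Longrightarrow> column_key N y A k m' = column_key N y A j m'"
    unfolding less_fun_def by blast
  \<comment> \<open>Coordinate 0 is either the deciding one or precedes it, where the keys
    agree.\<close>
  then have "column_key N y A k 0 \<le> column_key N y A j 0"
    by (cases "m = 0") auto
  then show "cmod (correlation N y A k) \<le> cmod (correlation N y A j)"
    by (simp add: column_key_def)
qed

text \<open>The coordinates up to \<open>2 * N\<close> depend only on \<open>y\<close> and the
  content of the column, so they travel with \<pi>. Distinct columns already differ there, in a real
  part at \<open>i\<close> or an imaginary part at \<open>N + i\<close>.\<close>

lemma matched_filter_permute_columns:
  assumes "\<pi> permutes {1..M}" and "distinct_columns N M A"
  shows "matched_filter N M L y (permute_columns N M \<pi> A) = \<pi> ` matched_filter N M L y A"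
proof -
  let ?B = "permute_columns N M \<pi> A"
  have entry: "?B (i, \<pi> j) = A (i, j)" if "i \<in> {1..N}" "j \<in> {1..M}" for i j
    using that permutes_in_image[OF assms(1), of j]
    by (auto simp: permute_columns_def permutes_inverses[OF assms(1)])
  have key: "column_key N y ?B (\<pi> j) m = column_key N y A j m" if "j \<in> {1..M}" "m \<le> 2 * N" for j m
  proof -
    have "correlation N y ?B (\<pi> j) = correlation N y A j"
      unfolding correlation_def using that entry by (intro sum.cong) auto
    moreover have "m \<le> N \<or> m - N \<in> {1..N}"
      using that by auto
    ultimately show ?thesis
      using that entry[of m j] entry[of "m - N" j] by (auto simp: column_key_def)
  qed
  have "less_fun (column_key N y ?B (\<pi> j)) (column_key N y ?B (\<pi> k))
      \<longleftrightarrow> less_fun (column_key N y A j) (column_key N y A k)"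
    if "j \<in> {1..M}" "k \<in> {1..M}" for j k
  proof (cases "j = k")
    case False
    then have "(\<lambda>i\<in>{1..N}. A (i, j)) \<noteq> (\<lambda>i\<in>{1..N}. A (i, k))"
      using inj_onD[OF assms(2)[unfolded distinct_columns_def]] that by blast
    then obtain i where i: "i \<in> {1..N}" "A (i, j) \<noteq> A (i, k)"
      by (meson restrict_ext)
    obtain m where "m \<le> 2 * N" "column_key N y A j m \<noteq> column_key N y A k m"
    proof (cases "Re (A (i, j)) = Re (A (i, k))")
      case True
      then show ?thesis
        using i by (intro that[of "N + i"]) (auto simp: column_key_def complex_eq_iff)
    next
      case False
      then show ?thesis
        using i by (intro that[of i]) (auto simp: column_key_def)
    qed
    then show ?thesis
      using key that by (intro less_fun_cong[of _ m]) auto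
  qed (simp add: less_fun_irrefl)
  then have "top_set (\<lambda>j k. less_fun (column_key N y ?B j) (column_key N y ?B k)) (\<pi> ` {1..M}) L
      = \<pi> ` top_set (\<lambda>j k. less_fun (column_key N y A j) (column_key N y A k)) {1..M} L"
    by (intro top_set_image) (use assms(1) in \<open>auto simp: permutes_inj_on\<close>)
  then show ?thesis
    by (simp only: matched_filter_def permutes_image[OF assms(1)])
qed

section \<open>Measurability of the decoder\<close>

lemma pred_less_fun:
  fixes f g :: "'a \<Rightarrow> nat \<Rightarrow> real"
  assumes [measurable]: "\<And>m. (\<lambda>w. f w m) \<in> borel_measurable Q" "\<And>m. (\<lambda>w. g w m) \<in> borel_measurable Q"
  shows "Measurable.pred Q (\<lambda>w. less_fun (f w) (g w))"
  unfolding less_fun_def by measurable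

text \<open>The range is finite, so preimages of singletons suffice, and these are finite
  combinations of the events that \<open>j\<close> is selected. Such an event bounds a finite count
  of measurable comparisons.\<close>

lemma measurable_matched_filter:
  assumes "L \<le> M"
  shows "(\<lambda>(y, A). matched_filter N M L y A)
    \<in> (\<Pi>\<^sub>M i \<in> {1..N}. borel) \<Otimes>\<^sub>M (\<Pi>\<^sub>M ij \<in> {1..N} \<times> {1..M}. borel)
      \<rightarrow>\<^sub>M count_space {S. S \<subseteq> {1..M} \<and> card S = L}"
proof -
  let ?Q = "(\<Pi>\<^sub>M i \<in> {1..N}. borel) \<Otimes>\<^sub>M (\<Pi>\<^sub>M ij \<in> {1..N} \<times> {1..M}. borel)
    :: ((nat \<Rightarrow> complex) \<times> (nat \<times> nat \<Rightarrow> complex)) measure"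
  have y: "(\<lambda>w. fst w i) \<in> borel_measurable ?Q" if "i \<in> {1..N}" for i
    using that by measurable
  have A: "(\<lambda>w. snd w p) \<in> borel_measurable ?Q" if "p \<in> {1..N} \<times> {1..M}" for p
    using that by measurable
  have key: "(\<lambda>w. column_key N (fst w) (snd w) j m) \<in> borel_measurable ?Q"
    if "j \<in> {1..M}" for j m
  proof -
    have [measurable]: "(\<lambda>w. snd w (i, j)) \<in> borel_measurable ?Q" if "i \<in> {1..N}" for i
      using A[of "(i, j)"] that \<open>j \<in> {1..M}\<close> by simp
    have "(\<lambda>w. cmod (correlation N (fst w) (snd w) j)) \<in> borel_measurable ?Q"
      unfolding correlation_def supply y [measurable] by measurable
    moreover have "(\<lambda>w. Re (snd w (i, j))) \<in> borel_measurable ?Q"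
      "(\<lambda>w. Im (snd w (i, j))) \<in> borel_measurable ?Q" if "i \<in> {1..N}" for i
      using A[of "(i, j)"] that \<open>j \<in> {1..M}\<close> by simp_all
    moreover have "m = 0 \<or> m \<in> {1..N} \<or> m - N \<in> {1..N} \<or> m > 2 * N"
      by auto
    ultimately show ?thesis
      unfolding column_key_def by (cases "m = 0"; cases "m \<le> N"; cases "m \<le> 2 * N"; cases "m = 2 * N + 1") auto
  qed
  have less: "Measurable.pred ?Q
      (\<lambda>w. less_fun (column_key N (fst w) (snd w) j) (column_key N (fst w) (snd w) k))"
    if "j \<in> {1..M}" "k \<in> {1..M}" for j k
    using that by (intro pred_less_fun key)
  have member: "Measurable.pred ?Q (\<lambda>w. j \<in> matched_filter N M L (fst w) (snd w))"
    if "j \<in> {1..M}" for j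
  proof -
    \<comment> \<open>\<open>measurable_card\<close> asks for this for every \<open>k\<close>;
      outside \<open>{1..M}\<close> the set is empty.\<close>
    have "{w \<in> space ?Q. k \<in> {k \<in> {1..M}. less_fun (column_key N (fst w) (snd w) j)
        (column_key N (fst w) (snd w) k)}} \<in> sets ?Q" for k
      using less[OF that, of k] by (cases "k \<in> {1..M}") (simp_all add: pred_def)
    then have "(\<lambda>w. card {k \<in> {1..M}. less_fun (column_key N (fst w) (snd w) j)
        (column_key N (fst w) (snd w) k)}) \<in> measurable ?Q (count_space UNIV)"
      by (rule measurable_card)
    then have "Measurable.pred ?Q (\<lambda>w. card {k \<in> {1..M}. less_fun (column_key N (fst w) (snd w) j)
        (column_key N (fst w) (snd w) k)} < L)"
      by (rule measurable_compose) simp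
    moreover have "j \<in> matched_filter N M L y A
        \<longleftrightarrow> card {k \<in> {1..M}. less_fun (column_key N y A j) (column_key N y A k)} < L" for y A
      using that by (simp add: matched_filter_def top_set_def)
    ultimately show ?thesis
      by (simp only:)
  qed
  have "(\<lambda>(y, A). matched_filter N M L y A) -` {S} \<inter> space ?Q
      = {w \<in> space ?Q. \<forall>j\<in>{1..M}. j \<in> matched_filter N M L (fst w) (snd w) \<longleftrightarrow> j \<in> S}"
    if "S \<subseteq> {1..M}" for S
  proof -
    have "matched_filter N M L y A = S \<longleftrightarrow> (\<forall>j\<in>{1..M}. j \<in> matched_filter N M L y A \<longleftrightarrow> j \<in> S)" for y A
      using that matched_filter_subset[OF assms, of N y A] by blast
    then show ?thesis by auto
  qed
  moreover have "{w \<in> space ?Q. \<forall>j\<in>{1..M}. j \<in> matched_filter N M L (fst w) (snd w) \<longleftrightarrow> j \<in> S}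
      \<in> sets ?Q" for S
  proof (intro sets.sets_Collect_finite_All)
    fix j assume "j \<in> {1..M}"
    then have "{w \<in> space ?Q. j \<in> matched_filter N M L (fst w) (snd w)} \<in> sets ?Q"
      using member by (simp add: pred_def)
    then show "{w \<in> space ?Q. j \<in> matched_filter N M L (fst w) (snd w) \<longleftrightarrow> j \<in> S} \<in> sets ?Q"
      by (cases "j \<in> S") (auto intro: sets.sets_Collect_neg)
  qed auto
  moreover have "countable {S. S \<subseteq> {1..M} \<and> card S = L}"
    by (rule countable_finite) simp
  ultimately show ?thesis
    using matched_filter_subset[OF assms] card_matched_filter[OF assms]
    by (subst measurable_count_space_eq_countable) (simp, fastforce)
qed

lemma is_decoder_matched_filter:
  assumes "L \<le> M"
  shows "is_decoder N M L (matched_filter N M L)"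
  unfolding is_decoder_def
  by (intro conjI allI ballI impI measurable_matched_filter[OF assms] matched_filter_permute_columns)

section \<open>Error probability\<close>

lemma successful3_greatest_scores:
  fixes z :: "nat \<Rightarrow> complex"
  assumes D: "D \<subseteq> {1..M}" "card D = sparsity M x"
    and top: "\<And>j k. j \<in> D \<Longrightarrow> k \<in> {1..M} - D \<Longrightarrow> cmod (z k) \<le> cmod (z j)"
    and signal: "\<And>k. k \<in> supp M x \<Longrightarrow> cmod (x k) - \<delta> < cmod (z k)"
    and noise: "\<And>j. j \<in> {1..M} - supp M x \<Longrightarrow> cmod (z j) < 2 * \<delta>"
    and \<delta>: "real (sparsity M x) * (3 * \<delta>)\<^sup>2 \<le> \<gamma> * energy M x"
    and pos: "0 < \<gamma>" "0 < energy M x"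
  shows "successful3 \<gamma> M x D"
proof -
  let ?I = "supp M x"
  have fin: "finite ?I" "finite D" "?I \<subseteq> {1..M}"
    using D(1) by (auto simp: supp_def intro: finite_subset)
  have "energy M x = (\<Sum>k\<in>?I. (cmod (x k))\<^sup>2)"
    unfolding energy_def by (rule sum.mono_neutral_right) (auto simp: supp_def)
  also have "\<dots> = (\<Sum>k\<in>D \<inter> ?I. (cmod (x k))\<^sup>2) + (\<Sum>k\<in>?I - D. (cmod (x k))\<^sup>2)"
    using sum.Int_Diff[OF fin(1), of _ D] by (simp add: Int_commute)
  finally have split: "energy M x = \<dots>" .
  have "(\<Sum>k\<in>?I - D. (cmod (x k))\<^sup>2) < \<gamma> * energy M x"
  proof (cases "?I - D = {}")
    \<comment> \<open>With nothing missed the sum is 0, and strictness comes from the positivity of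
      \<gamma> and of the energy.\<close>
    case True
    then show ?thesis using pos by (simp only: sum.empty) simp
  next
    case False
    \<comment> \<open>\<open>D\<close> and the support have equal size, so a missed support index
      forces a wrongly selected one.\<close>
    have "\<not> D \<subseteq> ?I"
      using card_subset_eq[OF fin(1), of D] D(2) False by (auto simp: sparsity_def)
    then obtain j where j: "j \<in> D" "j \<in> {1..M} - ?I"
      using D(1) by blast
    have "(cmod (x k))\<^sup>2 < (3 * \<delta>)\<^sup>2" if "k \<in> ?I - D" for k
    proof -
      have "cmod (x k) - \<delta> < 2 * \<delta>"
        using signal[of k] top[OF j(1), of k] noise[OF j(2)] that fin(3) by force
      then show ?thesis
        by (intro power_strict_mono) auto
    qed
    then have "(\<Sum>k\<in>?I - D. (cmod (x k))\<^sup>2) < (\<Sum>k\<in>?I - D. (3 * \<delta>)\<^sup>2)"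
      using fin False by (intro sum_strict_mono) auto
    also have "\<dots> \<le> real (sparsity M x) * (3 * \<delta>)\<^sup>2"
      using fin by (simp add: sparsity_def card_mono mult_right_mono)
    finally show ?thesis using \<delta> by linarith
  qed
  then show ?thesis
    using split unfolding successful3_def by (simp add: algebra_simps)
qed

text \<open>Finitely many directions in which lower bounds on real parts control the modulus: for
  \<open>a \<noteq> 0\<close> the phase of \<open>a\<close> itself, for \<open>a = 0\<close> the
  four axis directions, which confine \<open>z\<close> to a square around 0.\<close>

definition test_phases :: "complex \<Rightarrow> complex set" where
  "test_phases a = (if a = 0 then {1, -1, \<i>, -\<i>} else {sgn a})"

lemma
  shows finite_test_phases: "finite (test_phases a)"
    and card_test_phases_le: "card (test_phases a) \<le> 4"
    and norm_test_phases: "u \<in> test_phases a \<Longrightarrow> cmod u = 1"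
  by (auto simp: test_phases_def norm_sgn card_insert_if split: if_splits)

lemma
  assumes "\<And>u. u \<in> test_phases a \<Longrightarrow> Re (cnj u * a) - \<delta> < Re (cnj u * z)"
  shows test_phases_nonzero: "a \<noteq> 0 \<Longrightarrow> cmod a - \<delta> < cmod z"
    and test_phases_zero: "a = 0 \<Longrightarrow> cmod z < 2 * \<delta>"
proof -
  assume a: "a \<noteq> 0"
  have "cnj (sgn a) * a = of_real (cmod a)"
    using a by (simp add: sgn_eq complex_norm_square[symmetric] field_simps power2_eq_square)
  then have "Re (cnj (sgn a) * a) = cmod a"
    by (metis Re_complex_of_real)
  moreover have "Re (cnj (sgn a) * z) \<le> cmod z"
    using complex_Re_le_cmod[of "cnj (sgn a) * z"] a by (simp add: norm_mult norm_sgn)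
  ultimately show "cmod a - \<delta> < cmod z"
    using assms[of "sgn a"] a by (simp add: test_phases_def del: times_complex.sel)
next
  assume "a = 0"
  then have "\<bar>Re z\<bar> < \<delta>" "\<bar>Im z\<bar> < \<delta>"
    using assms[of 1] assms[of "-1"] assms[of \<i>] assms[of "-\<i>"] by (auto simp: test_phases_def)
  then show "cmod z < 2 * \<delta>"
    using cmod_le[of z] by linarith
qed

lemma sparsity_le: "sparsity M x \<le> M"
  using card_mono[of "{1..M}" "supp M x"] by (simp add: sparsity_def supp_def subset_iff)

lemma energy_pos:
  assumes "1 \<le> sparsity M x"
  shows "0 < energy M x"
proof -
  have "supp M x \<noteq> {}"
    using assms by (auto simp: sparsity_def)
  then obtain i where "i \<in> {1..M}" "x i \<noteq> 0"
    by (auto simp: supp_def)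
  then show ?thesis
    unfolding energy_def by (intro sum_pos2[of _ i]) auto
qed

text \<open>Union bound over at most \<open>4 * M\<close> pairs of an index and a test phase. The
  conditional Chernoff bound \<open>h\<close> dominates each failure probability for every matrix,
  and its mean over the matrix is at most \<open>B\<close>.\<close>

lemma p_err_matched_filter_le:
  assumes "0 < \<gamma>" "\<gamma> < 1" "0 < \<nu>" "1 \<le> N" "1 \<le> sparsity M x"
  defines "S \<equiv> energy M x + \<nu>\<^sup>2"
  shows "p_err \<gamma> \<nu> N M x (matched_filter N M (sparsity M x))
    \<le> 4 * real M * exp (- (real N * \<gamma> * energy M x / (108 * real (sparsity M x) * S)))"
proof -
  define L where "L = sparsity M x"
  define E where "E = energy M x"
  \<comment> \<open>\<delta> solves \<open>real L * (3 * \<delta>)\<^sup>2 = \<gamma> * E\<close>.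
    The value of \<open>s\<close> minimises \<open>3 * s\<^sup>2 * S - s * \<delta>\<close>, with
    minimum \<open>- (\<delta>\<^sup>2 / (12 * S))\<close>; hence 108 = 9 * 12.\<close>
  define \<delta> where "\<delta> = sqrt (\<gamma> * E / (9 * real L))"
  define s where "s = \<delta> / (6 * S)"
  \<comment> \<open>The tested correlation has mean \<open>real N * Re (cnj u * x k)\<close>; the
    threshold lies \<open>real N * \<delta>\<close> below it.\<close>
  define \<tau> where "\<tau> k u = real N * (Re (cnj u * x k) - \<delta>)" for k u
  define bad where "bad A k u = {n \<in> space (gaussian_noise \<nu> N).
      Re (cnj u * correlation N (observation N M x A n) A k) \<le> \<tau> k u}" for A k u
  define B where "B = exp (- (real N * \<gamma> * E / (108 * real L * S)))"
  have "L \<le> M"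
    by (simp add: L_def sparsity_le)
  have L: "L \<ge> 1" using assms by (simp add: L_def)
  have "0 < E"
    using assms(5) by (simp add: E_def energy_pos)
  then have S: "S > 0" "E \<le> S"
    using assms(3) by (simp_all add: S_def E_def add_pos_pos)
  have \<delta>: "\<delta>\<^sup>2 = \<gamma> * E / (9 * real L)" "0 \<le> \<delta>"
    using \<open>0 < E\<close> assms(1) by (simp_all add: \<delta>_def)
  have s: "s \<ge> 0" "s\<^sup>2 * S \<le> 1 / 16"
  proof -
    show "s \<ge> 0" using \<delta> S by (simp add: s_def)
    have "\<gamma> * E \<le> 1 * E"
      using assms(2) \<open>0 < E\<close> by (intro mult_right_mono) auto
    moreover have "E * 1 \<le> E * real L"
      using L \<open>0 < E\<close> by (intro mult_left_mono) auto
    \<comment> \<open>With \<open>E \<le> S\<close> this gives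
      \<open>s\<^sup>2 * S \<le> 1 / 36\<close>, inside the range where the averaged bound
      applies.\<close>
    ultimately have "\<delta>\<^sup>2 \<le> E"
      using L \<open>0 < E\<close> unfolding \<delta> by (simp add: divide_le_eq)
    then have "\<delta>\<^sup>2 / (36 * S) \<le> E / (36 * S)"
      using S by (intro divide_right_mono) auto
    also have "\<dots> \<le> 1 / 36"
      using S by (simp add: field_simps)
    finally show "s\<^sup>2 * S \<le> 1 / 16"
      using S by (simp add: s_def power_divide power_mult_distrib power2_eq_square[of S])
  qed
  have exponent: "s * \<tau> k u + real N * (- s * Re (cnj u * x k) + 3 * s\<^sup>2 * S)
      = - (real N * \<gamma> * E / (108 * real L * S))" for k u
  proof -
    have "s * \<tau> k u + real N * (- s * Re (cnj u * x k) + 3 * s\<^sup>2 * S) = real N * (3 * s\<^sup>2 * S - s * \<delta>)"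
      by (simp add: \<tau>_def algebra_simps)
    also have "3 * s\<^sup>2 * S - s * \<delta> = - (\<delta>\<^sup>2 / (12 * S))"
      using S by (simp add: s_def power_divide power_mult_distrib power2_eq_square field_simps)
    finally show ?thesis
      using L by (simp add: \<delta>)
  qed
  interpret A: prob_space "gaussian_matrix N M"
    unfolding gaussian_matrix_def by (intro prob_space_PiM prob_space_complex_gaussian) simp
  interpret n: prob_space "gaussian_noise \<nu> N"
    unfolding gaussian_noise_def using assms by (intro prob_space_PiM prob_space_complex_gaussian) simp
  define h where "h k u A = exp (s * \<tau> k u + cond_log_mgf \<nu> N M x k u s A)" for k u A
  have h: "integrable (gaussian_matrix N M) (h k u)" "(\<integral>A. h k u A \<partial>gaussian_matrix N M) \<le> B"
    if "k \<in> {1..M}" "u \<in> test_phases (x k)" for k u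
  proof -
    have [measurable]: "cond_log_mgf \<nu> N M x k u s \<in> borel_measurable (gaussian_matrix N M)"
      by (rule borel_measurable_cond_log_mgf) fact
    have "(\<integral>\<^sup>+A. ennreal (h k u A) \<partial>gaussian_matrix N M) = ennreal (exp (s * \<tau> k u))
        * (\<integral>\<^sup>+A. ennreal (exp (cond_log_mgf \<nu> N M x k u s A)) \<partial>gaussian_matrix N M)"
      by (simp add: h_def exp_add ennreal_mult nn_integral_cmult)
    also have "\<dots> \<le> ennreal (exp (s * \<tau> k u))
        * ennreal (exp (real N * (- s * Re (cnj u * x k) + 3 * s\<^sup>2 * S)))"
      unfolding S_def using that assms s norm_test_phases
      by (intro mult_left_mono nn_integral_exp_cond_log_mgf_le) (auto simp: S_def)
    also have "\<dots> = ennreal B"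
      unfolding ennreal_mult[OF exp_ge_zero exp_ge_zero, symmetric] exp_add[symmetric] exponent B_def ..
    finally have le: "(\<integral>\<^sup>+A. ennreal (h k u A) \<partial>gaussian_matrix N M) \<le> ennreal B" .
    have [measurable]: "h k u \<in> borel_measurable (gaussian_matrix N M)"
      unfolding h_def by measurable
    show "integrable (gaussian_matrix N M) (h k u)"
      by (rule integrableI_nonneg) (use le in \<open>auto simp: h_def intro: le_less_trans\<close>)
    show "(\<integral>A. h k u A \<partial>gaussian_matrix N M) \<le> B"
      by (rule integral_real_bounded[OF _ le]) (simp add: B_def)
  qed
  have "p_err_matrix \<gamma> \<nu> N M x (matched_filter N M L) A \<le> (\<Sum>k\<in>{1..M}. \<Sum>u\<in>test_phases (x k). h k u A)" for A
  proof -
    have success: "successful3 \<gamma> M x (matched_filter N M L (observation N M x A n) A)"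
      if n: "\<And>k u. k \<in> {1..M} \<Longrightarrow> u \<in> test_phases (x k)
        \<Longrightarrow> \<tau> k u < Re (cnj u * correlation N (observation N M x A n) A k)" for n
    proof -
      \<comment> \<open>Division by \<open>N\<close> centres the scores at \<open>x k\<close>
        without changing their order.\<close>
      define z where "z k = correlation N (observation N M x A n) A k / of_nat N" for k
      have z: "Re (cnj u * x k) - \<delta> < Re (cnj u * z k)" if "k \<in> {1..M}" "u \<in> test_phases (x k)" for k u
      proof -
        have "cnj u * correlation N (observation N M x A n) A k = of_real (real N) * (cnj u * z k)"
          using assms(4) by (simp add: z_def)
        then have "Re (cnj u * correlation N (observation N M x A n) A k) = real N * Re (cnj u * z k)"
          by (simp only: Re_complex_of_real times_complex.sel(1)[of "of_real _"] Im_complex_of_real mult_zero_left diff_zero)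
        with n[OF that] assms(4) show ?thesis
          by (simp add: \<tau>_def del: times_complex.sel)
      qed
      show ?thesis
      proof (rule successful3_greatest_scores[where z = z and \<delta> = \<delta>])
        show "cmod (z k) \<le> cmod (z j)" if "j \<in> matched_filter N M L (observation N M x A n) A"
          "k \<in> {1..M} - matched_filter N M L (observation N M x A n) A" for j k
          using matched_filter_le[OF \<open>L \<le> M\<close> that] by (simp add: z_def norm_divide divide_right_mono)
        show "cmod (x k) - \<delta> < cmod (z k)" if "k \<in> supp M x" for k
          using that by (intro test_phases_nonzero z) (auto simp: supp_def)
        show "cmod (z j) < 2 * \<delta>" if "j \<in> {1..M} - supp M x" for j
          using that by (intro test_phases_zero[of "x j"] z) (auto simp: supp_def)
        show "real (sparsity M x) * (3 * \<delta>)\<^sup>2 \<le> \<gamma> * energy M x"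
          using L by (simp add: power_mult_distrib \<delta> flip: L_def E_def)
      qed (use matched_filter_subset[OF \<open>L \<le> M\<close>] card_matched_filter[OF \<open>L \<le> M\<close>] assms(1) \<open>0 < E\<close>
          in \<open>auto simp flip: L_def E_def\<close>)
    qed
    have bad: "bad A k u \<in> sets (gaussian_noise \<nu> N)" for k u
    proof -
      have corr: "correlation N (observation N M x A n) A k
          = (\<Sum>i=1..N. cnj (A (i, k)) * ((\<Sum>j=1..M. A (i, j) * x j) + n i))" for n
        by (simp add: correlation_def observation_def)
      show ?thesis
        unfolding bad_def gaussian_noise_def corr by measurable
    qed
    have "{n \<in> space (gaussian_noise \<nu> N).
        \<not> successful3 \<gamma> M x (matched_filter N M L (observation N M x A n) A)}
      \<subseteq> (\<Union>k\<in>{1..M}. \<Union>u\<in>test_phases (x k). bad A k u)"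
    proof (rule subsetI, rule ccontr, elim CollectE conjE)
      fix n assume "n \<in> space (gaussian_noise \<nu> N)"
        and "n \<notin> (\<Union>k\<in>{1..M}. \<Union>u\<in>test_phases (x k). bad A k u)"
        and error: "\<not> successful3 \<gamma> M x (matched_filter N M L (observation N M x A n) A)"
      then have "\<not> Re (cnj u * correlation N (observation N M x A n) A k) \<le> \<tau> k u"
        if "k \<in> {1..M}" "u \<in> test_phases (x k)" for k u
        using that unfolding bad_def by blast
      then show False
        using error success[of n] unfolding not_le by blast
    qed
    then have "p_err_matrix \<gamma> \<nu> N M x (matched_filter N M L) A
        \<le> measure (gaussian_noise \<nu> N) (\<Union>k\<in>{1..M}. \<Union>u\<in>test_phases (x k). bad A k u)"
      unfolding p_err_matrix_def
      by (rule n.finite_measure_mono) (intro sets.finite_UN bad finite_test_phases finite_atLeastAtMost)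
    also have "\<dots> \<le> (\<Sum>k\<in>{1..M}. measure (gaussian_noise \<nu> N) (\<Union>u\<in>test_phases (x k). bad A k u))"
      by (intro n.finite_measure_subadditive_finite) (auto intro: bad finite_test_phases)
    also have "\<dots> \<le> (\<Sum>k\<in>{1..M}. \<Sum>u\<in>test_phases (x k). measure (gaussian_noise \<nu> N) (bad A k u))"
      by (intro sum_mono n.finite_measure_subadditive_finite finite_test_phases) (auto intro: bad)
    also have "\<dots> \<le> (\<Sum>k\<in>{1..M}. \<Sum>u\<in>test_phases (x k). h k u A)"
      unfolding bad_def h_def
      by (intro sum_mono measure_correlation_observation_le) (use assms s norm_test_phases in auto)
    finally show ?thesis .
  qed
  \<comment> \<open>The dominating sum is integrable and nonnegative, so the comparison also covers
    the default value 0 of the Bochner integral.\<close>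
  then have "p_err \<gamma> \<nu> N M x (matched_filter N M L)
      \<le> (\<integral>A. (\<Sum>k\<in>{1..M}. \<Sum>u\<in>test_phases (x k). h k u A) \<partial>gaussian_matrix N M)"
    unfolding p_err_def
    by (intro integral_mono' Bochner_Integration.integrable_sum h) (auto simp: h_def intro!: sum_nonneg)
  also have "\<dots> = (\<Sum>k\<in>{1..M}. \<Sum>u\<in>test_phases (x k). \<integral>A. h k u A \<partial>gaussian_matrix N M)"
    using h(1) by (simp add: Bochner_Integration.integral_sum)
  also have "\<dots> \<le> (\<Sum>k\<in>{1..M}. \<Sum>u\<in>test_phases (x k). B)"
    by (intro sum_mono h)
  also have "\<dots> = (\<Sum>k\<in>{1..M}. real (card (test_phases (x k))) * B)"
    by simp
  also have "\<dots> \<le> (\<Sum>k\<in>{1..M}. 4 * B)"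
    using card_test_phases_le by (intro sum_mono mult_right_mono) (auto simp: B_def)
  finally show ?thesis
    by (simp add: B_def E_def L_def mult_ac)
qed

section \<open>Choice of the constant and the limit\<close>

lemma matched_filter_union_bound_le:
  fixes N L M S \<gamma> P :: real
  assumes pos: "0 < \<gamma>" "0 < P" "0 < S" "0 < L"
    and sparse: "L \<le> M / 2" "4 \<le> M"
    and N: "216 * S / (\<gamma> * P) * L * ln (M - L) < N"
  shows "4 * M * exp (- (N * \<gamma> * P / (108 * L * S))) \<le> 16 / M"
proof -
  have "216 * S / (\<gamma> * P) * L * ln (M - L) * (\<gamma> * P / (108 * L * S)) \<le> N * (\<gamma> * P / (108 * L * S))"
    using N pos by (intro mult_right_mono) auto
  \<comment> \<open>As 216 = 2 * 108, the exponent becomes twice the logarithm. The resulting factor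
    \<open>1 / (M - L)\<^sup>2\<close> beats the \<open>4 * M\<close> events, since
    \<open>M - L \<ge> M / 2\<close>.\<close>
  moreover have "216 * S / (\<gamma> * P) * L * ln (M - L) * (\<gamma> * P / (108 * L * S)) = 2 * ln (M - L)"
    using pos by (simp add: field_simps)
  ultimately have "- (N * \<gamma> * P / (108 * L * S)) \<le> - (2 * ln (M - L))"
    by simp
  then have "exp (- (N * \<gamma> * P / (108 * L * S))) \<le> exp (- (2 * ln (M - L)))"
    by simp
  also have "\<dots> = 1 / (M - L)\<^sup>2"
    using sparse by (simp add: exp_minus exp_double inverse_eq_divide)
  also have "\<dots> \<le> 1 / (M / 2)\<^sup>2"
    using sparse by (intro divide_left_mono power_mono) auto
  finally have "4 * M * exp (- (N * \<gamma> * P / (108 * L * S))) \<le> 4 * M * (1 / (M / 2)\<^sup>2)"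
    using sparse by (intro mult_left_mono) auto
  also have "\<dots> = 16 / M"
    using sparse by (simp add: power2_eq_square)
  finally show ?thesis .
qed

theorem theoremV6:
  fixes \<gamma> \<nu> P :: real
  assumes "0 < \<gamma>" "\<gamma> < 1" "0 < \<nu>"
  shows "\<exists>C5>0. \<forall>(x :: nat \<Rightarrow> nat \<Rightarrow> complex) (N :: nat \<Rightarrow> nat).
    (\<forall>M\<ge>1. 1 \<le> sparsity M (x M)) \<longrightarrow>
    (\<lambda>M. real (sparsity M (x M))) \<in> o(\<lambda>M. real M) \<longrightarrow>
    (\<forall>M\<ge>1. energy M (x M) = P) \<longrightarrow>
    (\<forall>M\<ge>1. 1 \<le> N M) \<longrightarrow>
    (\<lambda>M. real (N M)) \<succ>
      (\<lambda>M. C5 * real (sparsity M (x M)) * ln (real M - real (sparsity M (x M)))) \<longrightarrow>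
    reliable_recovery_possible \<gamma> \<nu> N x"
proof (cases "P > 0")
  \<comment> \<open>A nonzero signal has positive energy, so the hypotheses contradict each other at
    \<open>M = 1\<close> and any positive witness will do.\<close>
  case False
  show ?thesis
  proof (intro exI[of _ 1] conjI allI impI)
    fix x :: "nat \<Rightarrow> nat \<Rightarrow> complex" and N :: "nat \<Rightarrow> nat"
    assume "\<forall>M\<ge>1. 1 \<le> sparsity M (x M)" "\<forall>M\<ge>1. energy M (x M) = P"
    then have "0 < energy 1 (x 1)" "energy 1 (x 1) = P"
      using energy_pos[of 1 "x 1"] by auto
    with False show "reliable_recovery_possible \<gamma> \<nu> N x" by simp
  qed simp
next
  case True
  define C where "C = 216 * (P + \<nu>\<^sup>2) / (\<gamma> * P)"
  have "C > 0"
    using True assms by (simp add: C_def add_pos_pos)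
  show ?thesis
  proof (intro exI[of _ C] conjI allI impI)
    fix x :: "nat \<Rightarrow> nat \<Rightarrow> complex" and N :: "nat \<Rightarrow> nat"
    define L where "L M = sparsity M (x M)" for M
    assume "\<forall>M\<ge>1. 1 \<le> sparsity M (x M)" and "(\<lambda>M. real (sparsity M (x M))) \<in> o(\<lambda>M. real M)"
      and "\<forall>M\<ge>1. energy M (x M) = P" and "\<forall>M\<ge>1. 1 \<le> N M"
      and "(\<lambda>M. real (N M)) \<succ>
        (\<lambda>M. C * real (sparsity M (x M)) * ln (real M - real (sparsity M (x M))))"
    note hyps = this[folded L_def]
    obtain M0 where M0: "\<And>M. M > M0 \<Longrightarrow> real (N M) / (C * real (L M) * ln (real M - real (L M))) > 1"
    proof -
      \<comment> \<open>This rules out the alternative of \<open>\<succ>\<close> in which both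
        functions vanish.\<close>
      have "real (N 1) \<noteq> 0"
        using hyps(4) by fastforce
      then show ?thesis
        using hyps(5) that unfolding dominates_def by blast
    qed
    have "eventually (\<lambda>M. norm (real (L M)) \<le> 1 / 2 * norm (real M)) sequentially"
      by (rule landau_o.smallD[OF hyps(2)]) simp
    then have bound: "eventually (\<lambda>M. p_err \<gamma> \<nu> (N M) M (x M) (matched_filter (N M) M (L M)) \<le> 16 / real M)
        sequentially"
      using eventually_gt_at_top[of M0] eventually_ge_at_top[of 4]
    proof eventually_elim
      case (elim M)
      have L: "1 \<le> L M" "real (L M) \<le> real M / 2" and M: "4 \<le> real M" and N: "1 \<le> N M"
        and E: "energy M (x M) = P"
        using elim hyps by auto
      \<comment> \<open>For \<open>M \<ge> 4\<close> and \<open>L M \<le> M / 2\<close> the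
        logarithm has argument at least 2. Positivity of the denominator turns the quotient
        condition into the required lower bound on \<open>N M\<close>.\<close>
      have "0 < C * real (L M) * ln (real M - real (L M))"
        using \<open>C > 0\<close> L M by (intro mult_pos_pos ln_gt_zero) auto
      then have "C * real (L M) * ln (real M - real (L M)) < real (N M)"
        using M0[OF elim(2)] by (simp add: less_divide_eq)
      then have "4 * real M * exp (- (real (N M) * \<gamma> * P / (108 * real (L M) * (P + \<nu>\<^sup>2)))) \<le> 16 / real M"
        using L M True assms unfolding C_def
        by (intro matched_filter_union_bound_le) (auto simp: add_pos_pos)
      then show ?case
        using p_err_matched_filter_le[OF assms N, of M "x M"] L(1) by (simp add: L_def E)
    qed
    have nonneg: "0 \<le> p_err \<gamma> \<nu> (N M) M (x M) D" for M D
      by (simp add: p_err_def p_err_matrix_def)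
    have "(\<lambda>M. p_err \<gamma> \<nu> (N M) M (x M) (matched_filter (N M) M (L M))) \<longlonglongrightarrow> 0"
    proof (rule tendsto_sandwich[OF _ bound tendsto_const])
      show "(\<lambda>M. 16 / real M) \<longlonglongrightarrow> 0"
        by (rule lim_const_over_n)
    qed (simp add: nonneg)
    then show "reliable_recovery_possible \<gamma> \<nu> N x"
      unfolding reliable_recovery_possible_def L_def
      by (intro exI[of _ "\<lambda>M. matched_filter (N M) M (sparsity M (x M))"])
        (simp add: is_decoder_matched_filter sparsity_le)
  qed (rule \<open>C > 0\<close>)
qed

end
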